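(* Let $G=K\rtimes_\theta Q\neq\{1\}$ be a semi-direct product with associated homomorphism $\theta:Q\to\mathrm{Aut}(K)$, $q\mapsto\theta_q$, and let $\Phi:FC(Q)\to\mathrm{Out}(K)$ be the homomorphism induced by $\theta$ (restriction of $\theta$ to $FC(Q)$ followed by $\mathrm{Aut}(K)\to\mathrm{Out}(K)$). Then $G$ is icc if and only if both of the following conditions hold: (i) $FC_G(K)=\{1\}$; (ii) for all $q\in\ker\Phi\setminus\{1\}$ and all $k\in K$ such that $\theta_q(x)=kxk^{-1}$ for every $x\in K$, the element $k$ has an infinite $\theta(Q)$-orbit.
   Context: A group is icc if it is infinite and all of its conjugacy classes except $\{1\}$ are infinite. In $G=K\rtimes_\theta Q$ one has $qkq^{-1}=\theta_q(k)$ for $q\in Q$, $k\in K$ ($K$ and $Q$ being identified with their images in $G$). $FC_G(K)$ is the set of elements of the normal subgroup $K$ whose $G$-conjugacy class is finite, and $FC(Q)$ is the subgroup of $Q$ consisting of elements with finite conjugacy class in $Q$. *)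

theory Defs
  imports "HOL-Algebra.Group_Action"
begin

definition conj_class :: "('a, 'm) monoid_scheme \<Rightarrow> 'a \<Rightarrow> 'a set"
  where "conj_class G x = {g \<otimes>\<^bsub>G\<^esub> x \<otimes>\<^bsub>G\<^esub> inv\<^bsub>G\<^esub> g | g. g \<in> carrier G}"

definition conj_classes :: "('a, 'm) monoid_scheme \<Rightarrow> 'a set set"
  where "conj_classes G = conj_class G ` carrier G"

definition icc :: "('a, 'm) monoid_scheme \<Rightarrow> bool"
  where "icc G \<longleftrightarrow> infinite (carrier G) \<and> (\<forall>C \<in> conj_classes G - {{\<one>\<^bsub>G\<^esub>}}. infinite C)"

text \<open>\<open>FC_in G N\<close> is $FC_G(N)$: the elements of \<open>N\<close> whose conjugacy class in the whole
  of \<open>G\<close> is finite.\<close>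

definition FC_in :: "('a, 'm) monoid_scheme \<Rightarrow> 'a set \<Rightarrow> 'a set"
  where "FC_in G N = {x \<in> N. finite (conj_class G x)}"

definition FC :: "('a, 'm) monoid_scheme \<Rightarrow> 'a set"
  where "FC G = FC_in G (carrier G)"

text \<open>Elements of \<^const>\<open>AutoGroup\<close> are extensional functions, hence the restrictions to
  the carrier.\<close>

definition inner_aut :: "('a, 'm) monoid_scheme \<Rightarrow> 'a \<Rightarrow> 'a \<Rightarrow> 'a"
  where "inner_aut K k = (\<lambda>x \<in> carrier K. k \<otimes>\<^bsub>K\<^esub> x \<otimes>\<^bsub>K\<^esub> inv\<^bsub>K\<^esub> k)"

definition Inn :: "('a, 'm) monoid_scheme \<Rightarrow> ('a \<Rightarrow> 'a) set"
  where "Inn K = inner_aut K ` carrier K"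

definition OutGroup :: "('a, 'm) monoid_scheme \<Rightarrow> ('a \<Rightarrow> 'a) set monoid"
  where "OutGroup K = AutoGroup K Mod Inn K"

definition semidirect ::
    "('a, 'm) monoid_scheme \<Rightarrow> ('b, 'n) monoid_scheme \<Rightarrow> ('b \<Rightarrow> 'a \<Rightarrow> 'a) \<Rightarrow> ('a \<times> 'b) monoid"
  where "semidirect K Q \<theta> =
    \<lparr>carrier = carrier K \<times> carrier Q,
     mult = (\<lambda>(k, q) (k', q'). (k \<otimes>\<^bsub>K\<^esub> \<theta> q k', q \<otimes>\<^bsub>Q\<^esub> q')),
     one = (\<one>\<^bsub>K\<^esub>, \<one>\<^bsub>Q\<^esub>)\<rparr>"

definition factor_image :: "('a, 'm) monoid_scheme \<Rightarrow> ('b, 'n) monoid_scheme \<Rightarrow> ('a \<times> 'b) set"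
  where "factor_image K Q = (\<lambda>k. (k, \<one>\<^bsub>Q\<^esub>)) ` carrier K"

definition FC_subgroup :: "('a, 'm) monoid_scheme \<Rightarrow> ('a, 'm) monoid_scheme"
  where "FC_subgroup G = G\<lparr>carrier := FC G\<rparr>"

text \<open>The map $\Phi \colon FC(Q) \to \mathrm{Out}(K)$ sends \<open>q\<close> to the coset of \<open>\<theta> q\<close>
  modulo \<open>Inn K\<close>.\<close>

definition outer_map ::
    "('a, 'm) monoid_scheme \<Rightarrow> ('b \<Rightarrow> 'a \<Rightarrow> 'a) \<Rightarrow> 'b \<Rightarrow> ('a \<Rightarrow> 'a) set"
  where "outer_map K \<theta> q = Inn K #>\<^bsub>AutoGroup K\<^esub> \<theta> q"

lemma hom_AutoGroup_auto:
  assumes "\<theta> \<in> hom Q (AutoGroup K)" "q \<in> carrier Q"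
  shows "\<theta> q \<in> auto K" using assms by (auto simp: hom_def AutoGroup_def)

lemma hom_AutoGroup_mult_apply:
  assumes "\<theta> \<in> hom Q (AutoGroup K)" "q \<in> carrier Q" "q' \<in> carrier Q" "x \<in> carrier K"
  shows "\<theta> (q \<otimes>\<^bsub>Q\<^esub> q') x = \<theta> q (\<theta> q' x)"
proof -
  have "\<theta> (q \<otimes>\<^bsub>Q\<^esub> q') = \<theta> q \<otimes>\<^bsub>AutoGroup K\<^esub> \<theta> q'" using assms by (simp add: hom_mult)
  thus ?thesis using hom_AutoGroup_auto[OF assms(1)] assms
    by (auto simp: AutoGroup_def BijGroup_def auto_def compose_def)
qed

lemma group_semidirect:
  assumes K: "group K" and Q: "group Q" and h: "\<theta> \<in> hom Q (AutoGroup K)"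
  shows "group (semidirect K Q \<theta>)"
proof -
  interpret K: group K by fact
  interpret Q: group Q by fact
  interpret H: group_hom Q "AutoGroup K" \<theta>
    by (simp add: group_hom_def group_hom_axioms_def h Q K.AutoGroup)
  have m: "\<theta> q x \<in> carrier K" if "q \<in> carrier Q" "x \<in> carrier K" for q x
    using hom_AutoGroup_auto[OF h that(1)] that by (auto simp: auto_def hom_def)
  have d: "\<theta> q (x \<otimes>\<^bsub>K\<^esub> y) = \<theta> q x \<otimes>\<^bsub>K\<^esub> \<theta> q y" if "q \<in> carrier Q" "x \<in> carrier K" "y \<in> carrier K" for q x y
    using hom_AutoGroup_auto[OF h that(1)] that by (auto simp: auto_def hom_def)
  have one: "\<theta> \<one>\<^bsub>Q\<^esub> x = x" if "x \<in> carrier K" for x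
    using H.hom_one that by (simp add: AutoGroup_def BijGroup_def)
  show ?thesis
  proof (rule groupI)
    fix x assume x: "x \<in> carrier (semidirect K Q \<theta>)"
    obtain k q where [simp]: "x = (k,q)" by (cases x)
    let ?y = "(\<theta> (inv\<^bsub>Q\<^esub> q) (inv\<^bsub>K\<^esub> k), inv\<^bsub>Q\<^esub> q)"
    have kq: "k \<in> carrier K" "q \<in> carrier Q" using x by (auto simp: semidirect_def)
    have "\<theta> (inv\<^bsub>Q\<^esub> q) \<one>\<^bsub>K\<^esub> = \<one>\<^bsub>K\<^esub>"
      using hom_AutoGroup_auto[OF h, of "inv\<^bsub>Q\<^esub> q"] kq K by (auto simp: auto_def intro: hom_one)
    then show "\<exists>y\<in>carrier (semidirect K Q \<theta>). y \<otimes>\<^bsub>semidirect K Q \<theta>\<^esub> x = \<one>\<^bsub>semidirect K Q \<theta>\<^esub>"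
      using kq by (intro bexI[of _ ?y]) (auto simp: semidirect_def m d[symmetric] simp del: H.hom_inv)
  qed (auto simp: semidirect_def m d one hom_AutoGroup_mult_apply[OF h] K.m_assoc Q.m_assoc simp del: H.hom_mult H.hom_one)
qed

lemma normal_Inn:
  assumes "group K"
  shows "Inn K \<lhd> AutoGroup K"
proof -
  interpret K: group K by fact
  interpret A: group "AutoGroup K" by (rule K.AutoGroup)
  have bij: "inner_aut K k \<in> auto K" if k: "k \<in> carrier K" for k
  proof -
    have "bij_betw (inner_aut K k) (carrier K) (carrier K)"
      by (rule bij_betw_byWitness[where f'="inner_aut K (inv\<^bsub>K\<^esub> k)"])
         (auto simp: inner_aut_def k K.m_assoc, auto simp: k K.m_assoc[symmetric])
    moreover have "inner_aut K k \<in> hom K K"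
      using k by (auto simp: hom_def inner_aut_def K.m_assoc) (simp add: K.m_assoc[symmetric])
    ultimately show ?thesis by (auto simp: auto_def Bij_def inner_aut_def)
  qed
  have mult: "inner_aut K a \<otimes>\<^bsub>AutoGroup K\<^esub> inner_aut K b = inner_aut K (a \<otimes>\<^bsub>K\<^esub> b)"
    if "a \<in> carrier K" "b \<in> carrier K" for a b
    using bij[OF that(1)] bij[OF that(2)] that
    by (auto simp: AutoGroup_def BijGroup_def auto_def)
       (auto simp: fun_eq_iff compose_def inner_aut_def K.m_assoc K.inv_mult_group)
  have one: "inner_aut K \<one>\<^bsub>K\<^esub> = \<one>\<^bsub>AutoGroup K\<^esub>"
    by (auto simp: AutoGroup_def BijGroup_def inner_aut_def)
  have hom: "group_hom K (AutoGroup K) (inner_aut K)"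
    using mult bij by (auto simp: group_hom_def group_hom_axioms_def hom_def assms A.group_axioms) (simp add: AutoGroup_def)
  have sub: "subgroup (Inn K) (AutoGroup K)" unfolding Inn_def by (rule group_hom.img_is_subgroup[OF hom])
  have carr: "carrier (AutoGroup K) = auto K" by (simp add: AutoGroup_def)
  have conj: "f \<otimes>\<^bsub>AutoGroup K\<^esub> inner_aut K a = inner_aut K (f a) \<otimes>\<^bsub>AutoGroup K\<^esub> f"
     if f: "f \<in> auto K" and a: "a \<in> carrier K" for f a
  proof -
    have fh: "f \<in> hom K K" and fb: "f \<in> Bij (carrier K)" using f by (auto simp: auto_def)
    interpret f: group_hom K K f using fh by unfold_locales
    show ?thesis using bij[OF a] bij[of "f a"] a fb
      by (auto simp: AutoGroup_def BijGroup_def auto_def)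
       (auto simp: fun_eq_iff compose_def inner_aut_def)
  qed
  show ?thesis
  proof (rule A.normal_invI[OF sub])
    fix f h assume f: "f \<in> carrier (AutoGroup K)" and "h \<in> Inn K"
    then obtain a where a: "a \<in> carrier K" "h = inner_aut K a" by (auto simp: Inn_def)
    have "f a \<in> carrier K" using f a by (auto simp: carr auto_def hom_def)
    moreover have "f \<otimes>\<^bsub>AutoGroup K\<^esub> h \<otimes>\<^bsub>AutoGroup K\<^esub> inv\<^bsub>AutoGroup K\<^esub> f = inner_aut K (f a)"
      using conj[of f a] f a bij[of "f a"] \<open>f a \<in> carrier K\<close> by (simp add: carr[symmetric] A.m_assoc)
    ultimately show "f \<otimes>\<^bsub>AutoGroup K\<^esub> h \<otimes>\<^bsub>AutoGroup K\<^esub> inv\<^bsub>AutoGroup K\<^esub> f \<in> Inn K" by (auto simp: Inn_def)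
  qed
qed

lemma subgroup_FC:
  assumes "group G"
  shows "subgroup (FC G) G"
proof -
  interpret group G by fact
  have one: "conj_class G \<one>\<^bsub>G\<^esub> \<subseteq> {\<one>\<^bsub>G\<^esub>}" by (auto simp: conj_class_def)
  have mul: "conj_class G (x \<otimes>\<^bsub>G\<^esub> y) \<subseteq> (\<lambda>(a,b). a \<otimes>\<^bsub>G\<^esub> b) ` (conj_class G x \<times> conj_class G y)"
    if xy: "x \<in> carrier G" "y \<in> carrier G" for x y
  proof
    fix z assume "z \<in> conj_class G (x \<otimes>\<^bsub>G\<^esub> y)"
    then obtain g where g: "g \<in> carrier G" "z = g \<otimes>\<^bsub>G\<^esub> (x \<otimes>\<^bsub>G\<^esub> y) \<otimes>\<^bsub>G\<^esub> inv\<^bsub>G\<^esub> g" by (auto simp: conj_class_def)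
    have "inv\<^bsub>G\<^esub> g \<otimes>\<^bsub>G\<^esub> (g \<otimes>\<^bsub>G\<^esub> w) = w" if "w \<in> carrier G" for w
      using g(1) that by (simp add: m_assoc[symmetric])
    then have "z = (g \<otimes>\<^bsub>G\<^esub> x \<otimes>\<^bsub>G\<^esub> inv\<^bsub>G\<^esub> g) \<otimes>\<^bsub>G\<^esub> (g \<otimes>\<^bsub>G\<^esub> y \<otimes>\<^bsub>G\<^esub> inv\<^bsub>G\<^esub> g)" using g xy by (simp add: m_assoc)
    then show "z \<in> (\<lambda>(a,b). a \<otimes>\<^bsub>G\<^esub> b) ` (conj_class G x \<times> conj_class G y)"
      using g by (auto simp: conj_class_def image_iff)
  qed
  have inv: "conj_class G (inv\<^bsub>G\<^esub> x) \<subseteq> (\<lambda>a. inv\<^bsub>G\<^esub> a) ` conj_class G x" if "x \<in> carrier G" for x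
  proof
    fix z assume "z \<in> conj_class G (inv\<^bsub>G\<^esub> x)"
    then obtain g where g: "g \<in> carrier G" "z = g \<otimes>\<^bsub>G\<^esub> inv\<^bsub>G\<^esub> x \<otimes>\<^bsub>G\<^esub> inv\<^bsub>G\<^esub> g" by (auto simp: conj_class_def)
    then have "z = inv\<^bsub>G\<^esub> (g \<otimes>\<^bsub>G\<^esub> x \<otimes>\<^bsub>G\<^esub> inv\<^bsub>G\<^esub> g)" using that by (simp add: inv_mult_group m_assoc)
    then show "z \<in> (\<lambda>a. inv\<^bsub>G\<^esub> a) ` conj_class G x" using g by (auto simp: conj_class_def)
  qed
  show ?thesis
  proof
    show "FC G \<subseteq> carrier G" by (auto simp: FC_def FC_in_def)
    show "\<one>\<^bsub>G\<^esub> \<in> FC G" using one by (auto simp: FC_def FC_in_def intro: finite_subset)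
    show "x \<otimes>\<^bsub>G\<^esub> y \<in> FC G" if "x \<in> FC G" "y \<in> FC G" for x y
      using that finite_subset[OF mul] by (auto simp: FC_def FC_in_def)
    show "inv\<^bsub>G\<^esub> x \<in> FC G" if "x \<in> FC G" for x
      using that finite_subset[OF inv] by (auto simp: FC_def FC_in_def)
  qed
qed

lemma outer_map_hom:
  assumes K: "group K" and "group Q" and h: "\<theta> \<in> hom Q (AutoGroup K)"
  shows "outer_map K \<theta> \<in> hom (FC_subgroup Q) (OutGroup K)"
proof -
  have "(\<lambda>a. Inn K #>\<^bsub>AutoGroup K\<^esub> a) \<in> hom (AutoGroup K) (OutGroup K)"
    unfolding OutGroup_def by (rule normal.r_coset_hom_Mod[OF normal_Inn[OF K]])
  from hom_compose[OF h this] show ?thesis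
    by (auto simp: hom_def outer_map_def FC_subgroup_def FC_def FC_in_def)
qed

end

theory Submission
  imports Defs
begin

text \<open>A nontrivial group is icc iff \<open>FC(G)\<close> is trivial. The commutator of
  \<open>w = (h, q) \<in> FC(G)\<close> with an element of \<open>K\<close> lies in \<open>K \<inter> FC(G)\<close>, so under (i) every
  such \<open>w\<close> centralizes \<open>K\<close>, which means that \<open>\<theta> q\<close> is conjugation by \<open>h\<^sup>-\<^sup>1\<close>. Conversely, if \<open>w\<close>
  centralizes \<open>K\<close>, then its conjugates are exactly the pairs \<open>(\<theta> p h, p q p\<^sup>-\<^sup>1)\<close>, so its class is
  finite iff both the \<open>\<theta>(Q)\<close>-orbit of \<open>h\<close> and the class of \<open>q\<close> in \<open>Q\<close> are finite.\<close>

section \<open>Finite conjugacy classes in an arbitrary group\<close>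

context group
begin

lemma conj_class_self: "x \<in> carrier G \<Longrightarrow> x \<in> conj_class G x"
  unfolding conj_class_def by (force intro: exI[of _ \<one>])

lemma conj_class_one [simp]: "conj_class G \<one> = {\<one>}"
  using conj_class_self[OF one_closed] by (auto simp: conj_class_def)

text \<open>Conjugating by \<open>g\<close> and then by \<open>a\<close> is conjugating by
  \<open>a \<otimes> g\<close>. The inclusion alone carries finiteness over to conjugates.\<close>

lemma conj_class_conj_subset:
  assumes "g \<in> carrier G" "x \<in> carrier G"
  shows "conj_class G (g \<otimes> x \<otimes> inv g) \<subseteq> conj_class G x"
proof
  fix z assume "z \<in> conj_class G (g \<otimes> x \<otimes> inv g)"
  then obtain a where a: "a \<in> carrier G" "z = a \<otimes> (g \<otimes> x \<otimes> inv g) \<otimes> inv a"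
    by (auto simp: conj_class_def)
  then have "z = (a \<otimes> g) \<otimes> x \<otimes> inv (a \<otimes> g)"
    using assms by (simp add: m_assoc inv_mult_group)
  then show "z \<in> conj_class G x"
    using a(1) assms(1) by (auto simp: conj_class_def)
qed

lemma FC_conj_closed:
  assumes "g \<in> carrier G" "x \<in> FC G"
  shows "g \<otimes> x \<otimes> inv g \<in> FC G"
  using assms finite_subset[OF conj_class_conj_subset[of g x]] by (auto simp: FC_def FC_in_def)

text \<open>The commutator is a conjugate of \<open>x\<close> times \<open>inv x\<close>, and
  \<open>FC G\<close> is a subgroup closed under conjugation.\<close>

lemma commutator_in_FC:
  assumes "g \<in> carrier G" "x \<in> FC G"
  shows "g \<otimes> x \<otimes> inv g \<otimes> inv x \<in> FC G"
proof -
  interpret F: subgroup "FC G" G by (rule subgroup_FC[OF is_group])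
  show ?thesis using FC_conj_closed assms by simp
qed

text \<open>The trivial group has trivial \<open>FC\<close> but is not icc. In a nontrivial group
  with trivial \<open>FC\<close>, the infinite class of some \<open>x\<close> already makes the
  carrier infinite.\<close>

lemma icc_iff_FC_trivial:
  assumes "carrier G \<noteq> {\<one>}"
  shows "icc G \<longleftrightarrow> FC G = {\<one>}"
proof
  assume icc: "icc G"
  have "x = \<one>" if "x \<in> FC G" for x
  proof -
    \<comment> \<open>In an icc group the only finite class is \<open>{\<one>}\<close>.\<close>
    have "conj_class G x = {\<one>}"
      using that icc by (auto simp: FC_def FC_in_def icc_def conj_classes_def)
    then show ?thesis using that conj_class_self[of x] by (auto simp: FC_def FC_in_def)
  qed
  then show "FC G = {\<one>}" by (auto simp: FC_def FC_in_def)
next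
  assume FC: "FC G = {\<one>}"
  have inf: "infinite (conj_class G x)" if "x \<in> carrier G" "x \<noteq> \<one>" for x
    using FC that by (auto simp: FC_def FC_in_def)
  obtain x where x: "x \<in> carrier G" "x \<noteq> \<one>" using assms one_closed by blast
  have "conj_class G x \<subseteq> carrier G" using x(1) by (auto simp: conj_class_def)
  then have "infinite (carrier G)" using inf[OF x] finite_subset by blast
  moreover have "infinite C" if C: "C \<in> conj_classes G - {{\<one>}}" for C
  proof -
    obtain y where y: "y \<in> carrier G" "C = conj_class G y"
      using C by (auto simp: conj_classes_def)
    moreover have "y \<noteq> \<one>" using C y(2) conj_class_one by blast
    ultimately show ?thesis using inf by blast
  qed
  ultimately show "icc G" by (simp add: icc_def)
qed

end

text \<open>The image of the pairing projects onto both factors and lies in their product. This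
  splits finiteness of a class in the semidirect product into two conditions.\<close>

lemma finite_image_Pair_iff:
  "finite ((\<lambda>x. (f x, g x)) ` A) \<longleftrightarrow> finite (f ` A) \<and> finite (g ` A)"
proof
  assume fin: "finite ((\<lambda>x. (f x, g x)) ` A)"
  show "finite (f ` A) \<and> finite (g ` A)"
    using finite_imageI[OF fin, of fst] finite_imageI[OF fin, of snd] by (simp add: image_image)
next
  assume "finite (f ` A) \<and> finite (g ` A)"
  then have "finite (f ` A \<times> g ` A)" by simp
  then show "finite ((\<lambda>x. (f x, g x)) ` A)" by (rule rev_finite_subset) auto
qed

section \<open>The semidirect product and its action\<close>

locale semidirect_product = K: group K + Q: group Q
  for K :: "('a, 'm) monoid_scheme" and Q :: "('b, 'n) monoid_scheme" +
  fixes \<theta> :: "'b \<Rightarrow> 'a \<Rightarrow> 'a"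
  assumes action_hom: "\<theta> \<in> hom Q (AutoGroup K)"
begin

abbreviation G where "G \<equiv> semidirect K Q \<theta>"

sublocale G: group G
  by (rule group_semidirect[OF K.group_axioms Q.group_axioms action_hom])

lemma action_group_hom: "q \<in> carrier Q \<Longrightarrow> group_hom K K (\<theta> q)"
  using hom_AutoGroup_auto[OF action_hom]
  by (auto simp: auto_def group_hom_def group_hom_axioms_def K.group_axioms)

lemma action_closed [simp]: "q \<in> carrier Q \<Longrightarrow> x \<in> carrier K \<Longrightarrow> \<theta> q x \<in> carrier K"
  using group_hom.hom_closed[OF action_group_hom] .

lemma action_by_one [simp]: "x \<in> carrier K \<Longrightarrow> \<theta> \<one>\<^bsub>Q\<^esub> x = x"
  using hom_one[OF action_hom Q.group_axioms K.AutoGroup] by (simp add: AutoGroup_def BijGroup_def)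

lemma action_one [simp]: "q \<in> carrier Q \<Longrightarrow> \<theta> q \<one>\<^bsub>K\<^esub> = \<one>\<^bsub>K\<^esub>"
  using group_hom.hom_one[OF action_group_hom] .

lemma action_inv: "q \<in> carrier Q \<Longrightarrow> x \<in> carrier K \<Longrightarrow> \<theta> q (inv\<^bsub>K\<^esub> x) = inv\<^bsub>K\<^esub> (\<theta> q x)"
  using group_hom.hom_inv[OF action_group_hom] .

lemma carrier_G [simp]: "(k, q) \<in> carrier G \<longleftrightarrow> k \<in> carrier K \<and> q \<in> carrier Q"
  by (simp add: semidirect_def)

lemma mult_G [simp]: "(k, q) \<otimes>\<^bsub>G\<^esub> (k', q') = (k \<otimes>\<^bsub>K\<^esub> \<theta> q k', q \<otimes>\<^bsub>Q\<^esub> q')"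
  by (simp add: semidirect_def)

lemma one_G: "\<one>\<^bsub>G\<^esub> = (\<one>\<^bsub>K\<^esub>, \<one>\<^bsub>Q\<^esub>)"
  by (simp add: semidirect_def)

lemma snd_hom: "group_hom G Q snd"
  by (auto simp: group_hom_def group_hom_axioms_def hom_def G.group_axioms Q.group_axioms)

section \<open>Conjugacy classes in the semidirect product\<close>

lemma conj_by_complement:
  assumes "p \<in> carrier Q" "h \<in> carrier K" "q \<in> carrier Q"
  shows "(\<one>\<^bsub>K\<^esub>, p) \<otimes>\<^bsub>G\<^esub> (h, q) \<otimes>\<^bsub>G\<^esub> inv\<^bsub>G\<^esub> (\<one>\<^bsub>K\<^esub>, p) = (\<theta> p h, p \<otimes>\<^bsub>Q\<^esub> q \<otimes>\<^bsub>Q\<^esub> inv\<^bsub>Q\<^esub> p)"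
proof -
  have "inv\<^bsub>G\<^esub> (\<one>\<^bsub>K\<^esub>, p) = (\<one>\<^bsub>K\<^esub>, inv\<^bsub>Q\<^esub> p)"
    by (rule G.inv_equality) (use assms in \<open>auto simp: one_G\<close>)
  then show ?thesis using assms by simp
qed

text \<open>These are the conjugates by elements of the complement \<open>Q\<close> alone.\<close>

lemma conj_class_superset:
  assumes "h \<in> carrier K" "q \<in> carrier Q"
  shows "(\<lambda>p. (\<theta> p h, p \<otimes>\<^bsub>Q\<^esub> q \<otimes>\<^bsub>Q\<^esub> inv\<^bsub>Q\<^esub> p)) ` carrier Q \<subseteq> conj_class G (h, q)"
proof
  fix z assume "z \<in> (\<lambda>p. (\<theta> p h, p \<otimes>\<^bsub>Q\<^esub> q \<otimes>\<^bsub>Q\<^esub> inv\<^bsub>Q\<^esub> p)) ` carrier Q"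
  then obtain p where "p \<in> carrier Q" "z = (\<one>\<^bsub>K\<^esub>, p) \<otimes>\<^bsub>G\<^esub> (h, q) \<otimes>\<^bsub>G\<^esub> inv\<^bsub>G\<^esub> (\<one>\<^bsub>K\<^esub>, p)"
    using conj_by_complement assms by auto
  then show "z \<in> conj_class G (h, q)" unfolding conj_class_def by fastforce
qed

text \<open>Each \<open>(a, p)\<close> factors as an element of \<open>Q\<close> times an element of
  \<open>K\<close>; the latter fixes \<open>(h, q)\<close> under conjugation, so only
  \<open>Q\<close> moves it.\<close>

lemma conj_class_of_centralizing:
  assumes hq: "h \<in> carrier K" "q \<in> carrier Q"
    and cent: "\<And>x. x \<in> carrier K \<Longrightarrow> (x, \<one>\<^bsub>Q\<^esub>) \<otimes>\<^bsub>G\<^esub> (h, q) = (h, q) \<otimes>\<^bsub>G\<^esub> (x, \<one>\<^bsub>Q\<^esub>)"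
  shows "conj_class G (h, q) = (\<lambda>p. (\<theta> p h, p \<otimes>\<^bsub>Q\<^esub> q \<otimes>\<^bsub>Q\<^esub> inv\<^bsub>Q\<^esub> p)) ` carrier Q"
proof (rule antisym[OF subsetI conj_class_superset[OF hq]])
  fix z assume "z \<in> conj_class G (h, q)"
  then obtain a p where ap: "a \<in> carrier K" "p \<in> carrier Q"
    and z: "z = (a, p) \<otimes>\<^bsub>G\<^esub> (h, q) \<otimes>\<^bsub>G\<^esub> inv\<^bsub>G\<^esub> (a, p)"
    by (auto simp: conj_class_def)
  \<comment> \<open>The twist by \<open>inv p\<close> cancels the action of \<open>p\<close> in the
    product \<open>?p \<otimes> ?n\<close>, leaving \<open>a\<close>.\<close>
  let ?x = "\<theta> (inv\<^bsub>Q\<^esub> p) a" and ?p = "(\<one>\<^bsub>K\<^esub>, p)"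
  let ?n = "(?x, \<one>\<^bsub>Q\<^esub>)"
  have "(a, p) = ?p \<otimes>\<^bsub>G\<^esub> ?n"
    using ap hom_AutoGroup_mult_apply[OF action_hom, of p "inv\<^bsub>Q\<^esub> p" a] by simp
  moreover have n: "?p \<in> carrier G" "?n \<in> carrier G" "(h, q) \<in> carrier G" using ap hq by auto
  moreover have "?n \<otimes>\<^bsub>G\<^esub> (h, q) = (h, q) \<otimes>\<^bsub>G\<^esub> ?n" using cent[of ?x] ap by auto
  \<comment> \<open>Removing \<open>mult_G\<close> keeps the products unevaluated, so that
    associativity in \<open>G\<close> applies.\<close>
  then have "?n \<otimes>\<^bsub>G\<^esub> (h, q) \<otimes>\<^bsub>G\<^esub> inv\<^bsub>G\<^esub> ?n = (h, q)" using n by (simp add: G.m_assoc del: mult_G)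
  moreover have "g \<otimes>\<^bsub>G\<^esub> n \<otimes>\<^bsub>G\<^esub> w \<otimes>\<^bsub>G\<^esub> inv\<^bsub>G\<^esub> (g \<otimes>\<^bsub>G\<^esub> n) = g \<otimes>\<^bsub>G\<^esub> (n \<otimes>\<^bsub>G\<^esub> w \<otimes>\<^bsub>G\<^esub> inv\<^bsub>G\<^esub> n) \<otimes>\<^bsub>G\<^esub> inv\<^bsub>G\<^esub> g"
    if "g \<in> carrier G" "n \<in> carrier G" "w \<in> carrier G" for g n w
    using that by (simp add: G.m_assoc G.inv_mult_group)
  ultimately have "z = ?p \<otimes>\<^bsub>G\<^esub> (h, q) \<otimes>\<^bsub>G\<^esub> inv\<^bsub>G\<^esub> ?p"
    using z by metis
  then show "z \<in> (\<lambda>p. (\<theta> p h, p \<otimes>\<^bsub>Q\<^esub> q \<otimes>\<^bsub>Q\<^esub> inv\<^bsub>Q\<^esub> p)) ` carrier Q"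
    using conj_by_complement ap hq by auto
qed

text \<open>Both second components are \<open>q\<close>; comparing the first ones gives the
  equation. Writing the \<open>K\<close>-component as \<open>inv k\<close> turns the action of
  \<open>q\<close> into conjugation by \<open>k\<close> itself, as in condition (ii).\<close>

lemma centralizes_iff:
  assumes "k \<in> carrier K" "q \<in> carrier Q" "x \<in> carrier K"
  shows "(x, \<one>\<^bsub>Q\<^esub>) \<otimes>\<^bsub>G\<^esub> (inv\<^bsub>K\<^esub> k, q) = (inv\<^bsub>K\<^esub> k, q) \<otimes>\<^bsub>G\<^esub> (x, \<one>\<^bsub>Q\<^esub>)
    \<longleftrightarrow> \<theta> q x = k \<otimes>\<^bsub>K\<^esub> x \<otimes>\<^bsub>K\<^esub> inv\<^bsub>K\<^esub> k"
proof -
  have "x \<otimes>\<^bsub>K\<^esub> inv\<^bsub>K\<^esub> k = inv\<^bsub>K\<^esub> k \<otimes>\<^bsub>K\<^esub> \<theta> q x \<longleftrightarrow> \<theta> q x = k \<otimes>\<^bsub>K\<^esub> (x \<otimes>\<^bsub>K\<^esub> inv\<^bsub>K\<^esub> k)"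
    by (rule K.inv_solve_left) (use assms in auto)
  then show ?thesis using assms by (simp add: K.m_assoc)
qed

section \<open>Orbits, the kernel of the outer action, and the factor K\<close>

lemma orbit_eq_image: "orbit Q \<theta> k = (\<lambda>p. \<theta> p k) ` carrier Q"
  by (auto simp: orbit_def)

text \<open>Each \<open>\<theta> p\<close> commutes with inversion, which is injective, so the
  orbits of \<open>k\<close> and \<open>inv k\<close> are in bijection.\<close>

lemma finite_orbit_inv_iff:
  assumes "k \<in> carrier K"
  shows "finite ((\<lambda>p. \<theta> p (inv\<^bsub>K\<^esub> k)) ` carrier Q) \<longleftrightarrow> finite (orbit Q \<theta> k)"
proof -
  have "(\<lambda>p. \<theta> p (inv\<^bsub>K\<^esub> k)) ` carrier Q = m_inv K ` orbit Q \<theta> k"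
    using assms by (auto simp: orbit_eq_image image_image action_inv)
  moreover have "inj_on (m_inv K) (orbit Q \<theta> k)"
    by (rule inj_on_subset[OF K.inv_inj]) (use assms in \<open>auto simp: orbit_def\<close>)
  ultimately show ?thesis by (simp add: finite_image_iff)
qed

lemma kernel_outer_mapI:
  assumes "q \<in> FC Q" "k \<in> carrier K" "\<And>x. x \<in> carrier K \<Longrightarrow> \<theta> q x = k \<otimes>\<^bsub>K\<^esub> x \<otimes>\<^bsub>K\<^esub> inv\<^bsub>K\<^esub> k"
  shows "q \<in> kernel (FC_subgroup Q) (OutGroup K) (outer_map K \<theta>)"
proof -
  have "\<theta> q \<in> auto K"
    using assms(1) hom_AutoGroup_auto[OF action_hom] by (auto simp: FC_def FC_in_def)
  \<comment> \<open>Both functions are extensional on \<open>carrier K\<close>, so agreement there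
    gives equality.\<close>
  then have "\<theta> q = inner_aut K k"
    using assms(3) by (auto simp: inner_aut_def auto_def Bij_def fun_eq_iff extensional_def)
  then have "\<theta> q \<in> Inn K" using assms(2) by (simp add: Inn_def)
  \<comment> \<open>The coset of a member of \<open>Inn K\<close> is \<open>Inn K\<close>, the
    identity of \<open>OutGroup K\<close>.\<close>
  then have "outer_map K \<theta> q = Inn K"
    unfolding outer_map_def
    by (rule subgroup.rcos_const[OF normal_imp_subgroup[OF normal_Inn[OF K.group_axioms]] K.AutoGroup])
  then show ?thesis
    using assms(1) by (simp add: kernel_def FC_subgroup_def OutGroup_def FactGroup_def)
qed

text \<open>Exhibits the copy of \<open>K\<close> as the kernel of \<open>snd\<close>, so that
  membership is checked in the second component.\<close>

lemma factor_image_eq: "factor_image K Q = {w \<in> carrier G. snd w = \<one>\<^bsub>Q\<^esub>}"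
  by (auto simp: factor_image_def)

lemma FC_in_factor_image: "FC_in G (factor_image K Q) = FC G \<inter> factor_image K Q"
  by (auto simp: FC_in_def FC_def factor_image_eq)

text \<open>The commutator of \<open>n\<close> and \<open>w\<close> is in \<open>FC G\<close>
  because \<open>w\<close> is, and \<open>snd\<close> kills it because \<open>snd n\<close> is
  trivial; condition (i) makes it trivial.\<close>

lemma FC_centralizes_factor:
  assumes "FC_in G (factor_image K Q) = {\<one>\<^bsub>G\<^esub>}" "w \<in> FC G" "n \<in> factor_image K Q"
  shows "n \<otimes>\<^bsub>G\<^esub> w = w \<otimes>\<^bsub>G\<^esub> n"
proof -
  interpret S: group_hom G Q snd by (rule snd_hom)
  have n: "n \<in> carrier G" "snd n = \<one>\<^bsub>Q\<^esub>" and w: "w \<in> carrier G"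
    using assms by (auto simp: factor_image_eq FC_def FC_in_def)
  have "n \<otimes>\<^bsub>G\<^esub> w \<otimes>\<^bsub>G\<^esub> inv\<^bsub>G\<^esub> n \<otimes>\<^bsub>G\<^esub> inv\<^bsub>G\<^esub> w \<in> FC G \<inter> factor_image K Q"
    using G.commutator_in_FC[OF n(1) assms(2)] n w by (simp add: factor_image_eq)
  then have "n \<otimes>\<^bsub>G\<^esub> w \<otimes>\<^bsub>G\<^esub> inv\<^bsub>G\<^esub> n \<otimes>\<^bsub>G\<^esub> inv\<^bsub>G\<^esub> w = \<one>\<^bsub>G\<^esub>"
    using assms(1) unfolding FC_in_factor_image by blast
  then have "n \<otimes>\<^bsub>G\<^esub> w \<otimes>\<^bsub>G\<^esub> inv\<^bsub>G\<^esub> (w \<otimes>\<^bsub>G\<^esub> n) = \<one>\<^bsub>G\<^esub>"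
    using n w by (simp add: G.inv_mult_group G.m_assoc)
  \<comment> \<open>The product with \<open>inv (w \<otimes> n)\<close> is trivial, so
    \<open>n \<otimes> w\<close> is the inverse of that inverse.\<close>
  then show ?thesis using n w G.inv_equality[of "n \<otimes>\<^bsub>G\<^esub> w" "inv\<^bsub>G\<^esub> (w \<otimes>\<^bsub>G\<^esub> n)"] by simp
qed

section \<open>Triviality of \<open>FC G\<close> in terms of the two conditions\<close>

lemma conj_class_Q_eq: "conj_class Q q = (\<lambda>p. p \<otimes>\<^bsub>Q\<^esub> q \<otimes>\<^bsub>Q\<^esub> inv\<^bsub>Q\<^esub> p) ` carrier Q"
  by (auto simp: conj_class_def)

lemma inner_action_imp_in_FC:
  assumes q: "q \<in> FC Q" and k: "k \<in> carrier K"
    and act: "\<And>x. x \<in> carrier K \<Longrightarrow> \<theta> q x = k \<otimes>\<^bsub>K\<^esub> x \<otimes>\<^bsub>K\<^esub> inv\<^bsub>K\<^esub> k"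
    and fin: "finite (orbit Q \<theta> k)"
  shows "(inv\<^bsub>K\<^esub> k, q) \<in> FC G"
proof -
  have q': "q \<in> carrier Q" "finite (conj_class Q q)" using q by (auto simp: FC_def FC_in_def)
  have "conj_class G (inv\<^bsub>K\<^esub> k, q) =
      (\<lambda>p. (\<theta> p (inv\<^bsub>K\<^esub> k), p \<otimes>\<^bsub>Q\<^esub> q \<otimes>\<^bsub>Q\<^esub> inv\<^bsub>Q\<^esub> p)) ` carrier Q"
    \<comment> \<open>Restricting the simplifier lets \<open>centralizes_iff\<close> match before
      \<open>mult_G\<close> can evaluate the products.\<close>
    using k q' act by (intro conj_class_of_centralizing) (simp_all only: centralizes_iff K.inv_closed)
  then have "finite (conj_class G (inv\<^bsub>K\<^esub> k, q))"
    using fin q' k by (simp add: finite_image_Pair_iff finite_orbit_inv_iff conj_class_Q_eq)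
  then show ?thesis using k q' by (simp add: FC_def FC_in_def)
qed

text \<open>The conjugates by \<open>Q\<close> form a subset of the finite class, and their two
  components run through the orbit of \<open>inv k\<close> and the class of
  \<open>q\<close>.\<close>

lemma FC_components:
  assumes "(inv\<^bsub>K\<^esub> k, q) \<in> FC G" "k \<in> carrier K"
  shows "q \<in> FC Q" "finite (orbit Q \<theta> k)"
proof -
  have q: "q \<in> carrier Q" and fin: "finite (conj_class G (inv\<^bsub>K\<^esub> k, q))"
    using assms by (auto simp: FC_def FC_in_def)
  have "finite ((\<lambda>p. (\<theta> p (inv\<^bsub>K\<^esub> k), p \<otimes>\<^bsub>Q\<^esub> q \<otimes>\<^bsub>Q\<^esub> inv\<^bsub>Q\<^esub> p)) ` carrier Q)"
    using finite_subset[OF conj_class_superset fin] assms q by simp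
  then show "q \<in> FC Q" "finite (orbit Q \<theta> k)"
    using assms q
    by (simp_all add: finite_image_Pair_iff finite_orbit_inv_iff conj_class_Q_eq FC_def FC_in_def)
qed

lemma FC_trivial_iff:
  "FC G = {\<one>\<^bsub>G\<^esub>} \<longleftrightarrow>
    FC_in G (factor_image K Q) = {\<one>\<^bsub>G\<^esub>} \<and>
    (\<forall>q \<in> kernel (FC_subgroup Q) (OutGroup K) (outer_map K \<theta>) - {\<one>\<^bsub>Q\<^esub>}.
      \<forall>k \<in> carrier K.
        (\<forall>x \<in> carrier K. \<theta> q x = k \<otimes>\<^bsub>K\<^esub> x \<otimes>\<^bsub>K\<^esub> inv\<^bsub>K\<^esub> k) \<longrightarrow> infinite (orbit Q \<theta> k))"
    (is "_ \<longleftrightarrow> ?i \<and> ?ii")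
proof
  assume FC: "FC G = {\<one>\<^bsub>G\<^esub>}"
  have ?i unfolding FC_in_factor_image FC by (auto simp: factor_image_eq one_G)
  moreover have ?ii
  proof (intro ballI impI notI)
    fix q k
    assume "q \<in> kernel (FC_subgroup Q) (OutGroup K) (outer_map K \<theta>) - {\<one>\<^bsub>Q\<^esub>}" "k \<in> carrier K"
      "\<forall>x \<in> carrier K. \<theta> q x = k \<otimes>\<^bsub>K\<^esub> x \<otimes>\<^bsub>K\<^esub> inv\<^bsub>K\<^esub> k" "finite (orbit Q \<theta> k)"
    \<comment> \<open>A finite orbit would produce this element of \<open>FC G\<close>, nontrivial
      since \<open>q\<close> is; the kernel is taken inside \<open>FC Q\<close>.\<close>
    then have "(inv\<^bsub>K\<^esub> k, q) \<in> FC G" "q \<noteq> \<one>\<^bsub>Q\<^esub>"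
      by (auto intro!: inner_action_imp_in_FC simp: kernel_def FC_subgroup_def)
    then show False using FC by (simp add: one_G)
  qed
  ultimately show "?i \<and> ?ii" ..
next
  assume "?i \<and> ?ii"
  then have i: ?i and ii: ?ii by blast+
  have "w = \<one>\<^bsub>G\<^esub>" if w: "w \<in> FC G" for w
  proof (rule ccontr)
    assume nontriv: "w \<noteq> \<one>\<^bsub>G\<^esub>"
    obtain h q where hq: "w = (h, q)" by fastforce
    define k where "k = inv\<^bsub>K\<^esub> h"
    have car: "h \<in> carrier K" "k \<in> carrier K" "q \<in> carrier Q"
      using w by (auto simp: hq FC_def FC_in_def k_def)
    have wk: "w = (inv\<^bsub>K\<^esub> k, q)" using car(1) by (simp add: hq k_def)
    \<comment> \<open>By (i), a nontrivial element of \<open>FC G\<close> lies outside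
      \<open>K\<close>, which gives the nontrivial \<open>q\<close> required in (ii).\<close>
    have "w \<notin> factor_image K Q"
      using i nontriv w unfolding FC_in_factor_image by blast
    then have "q \<noteq> \<one>\<^bsub>Q\<^esub>" using car by (simp add: factor_image_eq hq)
    moreover have act: "\<theta> q x = k \<otimes>\<^bsub>K\<^esub> x \<otimes>\<^bsub>K\<^esub> inv\<^bsub>K\<^esub> k" if "x \<in> carrier K" for x
      using FC_centralizes_factor[OF i w, of "(x, \<one>\<^bsub>Q\<^esub>)"] that car
      unfolding wk by (simp only: centralizes_iff) (simp add: factor_image_eq)
    moreover note FC_components[OF w[unfolded wk] car(2)]
    ultimately show False using ii kernel_outer_mapI car(2) by blast
  qed
  moreover have "\<one>\<^bsub>G\<^esub> \<in> FC G" by (simp add: FC_def FC_in_def)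
  ultimately show "FC G = {\<one>\<^bsub>G\<^esub>}" by blast
qed

end

theorem theorem3p1:
  fixes K :: "('a, 'm) monoid_scheme" and Q :: "('b, 'n) monoid_scheme"
    and \<theta> :: "'b \<Rightarrow> 'a \<Rightarrow> 'a"
  assumes "group K" and "group Q"
    and "\<theta> \<in> hom Q (AutoGroup K)"
    and "carrier (semidirect K Q \<theta>) \<noteq> {\<one>\<^bsub>semidirect K Q \<theta>\<^esub>}"
  shows "icc (semidirect K Q \<theta>) \<longleftrightarrow>
    FC_in (semidirect K Q \<theta>) (factor_image K Q) = {\<one>\<^bsub>semidirect K Q \<theta>\<^esub>} \<and>
    (\<forall>q \<in> kernel (FC_subgroup Q) (OutGroup K) (outer_map K \<theta>) - {\<one>\<^bsub>Q\<^esub>}.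
      \<forall>k \<in> carrier K.
        (\<forall>x \<in> carrier K. \<theta> q x = k \<otimes>\<^bsub>K\<^esub> x \<otimes>\<^bsub>K\<^esub> inv\<^bsub>K\<^esub> k) \<longrightarrow> infinite (orbit Q \<theta> k))"
proof -
  interpret semidirect_product K Q \<theta>
    using assms by (simp add: semidirect_product_def semidirect_product_axioms_def)
  show ?thesis using G.icc_iff_FC_trivial[OF assms(4)] FC_trivial_iff by simp
qed

end
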